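(* Let $G$ be a strictly unimodal uniform grid with associated integer $N$. For every $d\in[0,N]$ and every $E\subseteq[0,N]$: (a) $\overline{L}_{N,d}(E)\ne[0,N]$ if and only if $E$ is $d$-admitting; (b) $\overline{L}_{N,d}(E)=E$ if and only if $T_{N,|E|-d}\subseteq E$.
   Context: For integers $a\le b$, $[a,b]$ denotes the set of integers $t$ with $a\le t\le b$ (and $[a,b]=\emptyset$ if $a>b$); $[n]=[1,n]$. A uniform grid is a set $G=[0,k_1-1]\times\cdots\times[0,k_n-1]\subseteq\mathbb{R}^n$ with $n\ge1$ and integers $k_i\ge2$; put $N=\sum_{i\in[n]}(k_i-1)$. For $j\in[0,N]$ let $\underline{j}=\{x\in G:\sum_{i\in[n]}x_i=j\}$. The grid $G$ is strictly unimodal if $|\underline{0}|<|\underline{1}|<\cdots<|\underline{\lfloor N/2\rfloor}|=|\underline{\lceil N/2\rceil}|>\cdots>|\underline{N}|$. For $d\in[0,N]$ and $E=\{t_1<\cdots<t_s\}\subseteq[0,N]$, define $L_{N,d}(E)=E$ if $|E|\le d$, and $L_{N,d}(E)=[0,t_{s-d}]\cup E\cup[t_{d+1},N]$ if $|E|\ge d+1$. With $L_{N,d}^0=\mathrm{id}$ and $L_{N,d}^{k+1}=L_{N,d}\circ L_{N,d}^k$, define $\overline{L}_{N,d}(E)=\bigcup_{k\ge0}L_{N,d}^k(E)$. For an integer $i$ let $T_{N,i}=([0,i-1]\cup[N-i+1,N])\cap[0,N]$; in particular $T_{N,i}=\emptyset$ for $i\le0$. For $d,i\in[0,N]$ with $i\le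 d$, a set $E\subseteq[0,N]$ is $(d,i)$-admitting if $E\cup T_{N,i}\ne[0,N]$ and $|E\setminus T_{N,i}|\le d-i$. $E$ is $d$-admitting if it is $(d,i)$-admitting for some $i\in[0,d]$. *)

theory Defs
  imports "HOL-Analysis.Analysis"
begin

text \<open>
  A family \<open>k\<close> of side lengths indexed by the finite type \<open>'n\<close> describes the grid
  \<open>[0, k\<^sub>1 - 1] \<times> \<dots> \<times> [0, k\<^sub>n - 1]\<close> in \<open>real ^ 'n\<close>.
  It is a uniform grid in the intended sense only if all \<open>k i \<ge> 2\<close>.
\<close>

definition uniform_grid :: "('n::finite \<Rightarrow> int) \<Rightarrow> (real ^ 'n) set" where
  "uniform_grid k = {x. \<forall>i. x $ i \<in> real_of_int ` {0..k i - 1}}"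

definition grid_N :: "('n::finite \<Rightarrow> int) \<Rightarrow> int" where
  "grid_N k = (\<Sum>i\<in>UNIV. k i - 1)"

definition layer :: "(real ^ 'n::finite) set \<Rightarrow> int \<Rightarrow> (real ^ 'n) set" where
  "layer G j = {x \<in> G. (\<Sum>i\<in>UNIV. x $ i) = real_of_int j}"

definition strictly_unimodal :: "('n::finite \<Rightarrow> int) \<Rightarrow> bool" where
  "strictly_unimodal k \<longleftrightarrow>
     (let G = uniform_grid k; N = grid_N k;
          lo = \<lfloor>real_of_int N / 2\<rfloor>; hi = \<lceil>real_of_int N / 2\<rceil>
      in (\<forall>j. 0 \<le> j \<and> j < lo \<longrightarrow> card (layer G j) < card (layer G (j + 1))) \<and>
         card (layer G lo) = card (layer G hi) \<and>
         (\<forall>j. hi \<le> j \<and> j < N \<longrightarrow> card (layer G j) > card (layer G (j + 1))))"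

text \<open>
  \<open>nth_elem E m\<close> is the \<open>m\<close>-th smallest element \<open>t\<^sub>m\<close> of a finite set \<open>E\<close>, counting from 1;
  it is meaningful only for \<open>1 \<le> m \<le> |E|\<close>.
\<close>

definition nth_elem :: "int set \<Rightarrow> int \<Rightarrow> int" where
  "nth_elem E m = sorted_list_of_set E ! nat (m - 1)"

definition L_op :: "int \<Rightarrow> int \<Rightarrow> int set \<Rightarrow> int set" where
  "L_op N d E =
     (if int (card E) \<le> d then E
      else {0..nth_elem E (int (card E) - d)} \<union> E \<union> {nth_elem E (d + 1)..N})"

definition L_closure :: "int \<Rightarrow> int \<Rightarrow> int set \<Rightarrow> int set" where
  "L_closure N d E = (\<Union>j::nat. (L_op N d ^^ j) E)"

definition T_set :: "int \<Rightarrow> int \<Rightarrow> int set" where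
  "T_set N i = ({0..i - 1} \<union> {N - i + 1..N}) \<inter> {0..N}"

definition di_admitting :: "int \<Rightarrow> int \<Rightarrow> int \<Rightarrow> int set \<Rightarrow> bool" where
  "di_admitting N d i E \<longleftrightarrow>
     E \<union> T_set N i \<noteq> {0..N} \<and> int (card (E - T_set N i)) \<le> d - i"

definition d_admitting :: "int \<Rightarrow> int \<Rightarrow> int set \<Rightarrow> bool" where
  "d_admitting N d E \<longleftrightarrow> (\<exists>i\<in>{0..d}. di_admitting N d i E)"

end

(* Membership of x in L_op N d E only depends on whether more than d elements of E lie weakly above x,
   or weakly below x. Hence L_op is monotone, and its fixed points are exactly the sets E containing
   T_set N (|E| - d). The closure of E is the least fixed point above E. A fixed point other than
   [0, N] is admitting with i = max 0 (|E| - d), and being admitting passes to subsets; conversely, if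
   E is (d, i)-admitting, then E \<union> T_set N i is a fixed point, because it has at most d + i elements. *)

theory Submission
  imports Defs
begin

section \<open>Order statistics as counting conditions\<close>

text \<open>If entry \<open>p\<close> is at most \<open>x\<close>, positions \<open>0..p\<close>
  supply \<open>p + 1\<close> distinct elements below \<open>x\<close>; otherwise all elements below
  \<open>x\<close> sit at positions before \<open>p\<close>. This turns the thresholds in
  \<open>L_op\<close> into counts.\<close>

lemma sorted_list_nth_le_iff:
  fixes A :: "'a::linorder set"
  assumes "finite A" "p < card A"
  shows "sorted_list_of_set A ! p \<le> x \<longleftrightarrow> p < card {a\<in>A. a \<le> x}"
proof -
  let ?xs = "sorted_list_of_set A"
  have len: "length ?xs = card A" by simp
  have set: "set ?xs = A" using assms by simp
  have srt: "sorted ?xs" and dis: "distinct ?xs" by simp_all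
  show ?thesis
  proof
    assume le: "?xs ! p \<le> x"
    have "inj_on ((!) ?xs) {..p}"
      using assms len dis by (intro inj_on_nth) auto
    then have "card ((!) ?xs ` {..p}) = Suc p" by (simp add: card_image)
    moreover have "?xs ! q \<in> {a\<in>A. a \<le> x}" if "q \<le> p" for q
    proof -
      have "?xs ! q \<in> A" using that assms len set by (metis le_less_trans nth_mem)
      moreover have "?xs ! q \<le> ?xs ! p" using srt that assms len by (intro sorted_nth_mono) auto
      ultimately show ?thesis using le by auto
    qed
    then have "card ((!) ?xs ` {..p}) \<le> card {a\<in>A. a \<le> x}"
      using assms(1) by (intro card_mono) auto
    ultimately show "p < card {a\<in>A. a \<le> x}" by simp
  next
    assume lt: "p < card {a\<in>A. a \<le> x}"
    show "?xs ! p \<le> x"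
    proof (rule ccontr)
      assume gt: "\<not> ?xs ! p \<le> x"
      have "{a\<in>A. a \<le> x} \<subseteq> (!) ?xs ` {..<p}"
      proof
        fix a assume a: "a \<in> {a\<in>A. a \<le> x}"
        then obtain q where q: "q < card A" "a = ?xs ! q"
          using set len by (metis (no_types, lifting) in_set_conv_nth mem_Collect_eq)
        have "q < p"
          using a gt q srt len by (metis (no_types, lifting) linorder_not_le mem_Collect_eq order_trans sorted_nth_mono)
        then show "a \<in> (!) ?xs ` {..<p}" using q by auto
      qed
      then have "card {a\<in>A. a \<le> x} \<le> card ((!) ?xs ` {..<p})" by (intro card_mono) auto
      also have "\<dots> \<le> p" using card_image_le[of "{..<p}" "(!) ?xs"] by simp
      finally show False using lt by simp
    qed
  qed
qed

text \<open>Mirror image of the preceding count: positions \<open>p\<close> up to the end hold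
  \<open>card A - p\<close> elements.\<close>

lemma le_sorted_list_nth_iff:
  fixes A :: "'a::linorder set"
  assumes "finite A" "p < card A"
  shows "x \<le> sorted_list_of_set A ! p \<longleftrightarrow> card A - p \<le> card {a\<in>A. x \<le> a}"
proof -
  let ?xs = "sorted_list_of_set A"
  have len: "length ?xs = card A" by simp
  have set: "set ?xs = A" using assms by simp
  have srt: "sorted ?xs" and dis: "distinct ?xs" by simp_all
  show ?thesis
  proof
    assume le: "x \<le> ?xs ! p"
    have "inj_on ((!) ?xs) {p..<card A}"
      using len dis by (intro inj_on_nth) auto
    then have "card ((!) ?xs ` {p..<card A}) = card A - p" by (simp add: card_image)
    moreover have "?xs ! q \<in> {a\<in>A. x \<le> a}" if "p \<le> q" "q < card A" for q
    proof -
      have "?xs ! q \<in> A" using that len set by (metis nth_mem)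
      moreover have "?xs ! p \<le> ?xs ! q" using srt that len by (intro sorted_nth_mono) auto
      ultimately show ?thesis using le by auto
    qed
    then have "card ((!) ?xs ` {p..<card A}) \<le> card {a\<in>A. x \<le> a}"
      using assms(1) by (intro card_mono) auto
    ultimately show "card A - p \<le> card {a\<in>A. x \<le> a}" by simp
  next
    assume lt: "card A - p \<le> card {a\<in>A. x \<le> a}"
    show "x \<le> ?xs ! p"
    proof (rule ccontr)
      assume gt: "\<not> x \<le> ?xs ! p"
      have "{a\<in>A. x \<le> a} \<subseteq> (!) ?xs ` {Suc p..<card A}"
      proof
        fix a assume a: "a \<in> {a\<in>A. x \<le> a}"
        then obtain q where q: "q < card A" "a = ?xs ! q"
          using set len by (metis (no_types, lifting) in_set_conv_nth mem_Collect_eq)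
        have "p < q"
        proof (rule ccontr)
          assume "\<not> p < q"
          then have "a \<le> ?xs ! p" using q srt len assms by (auto intro: sorted_nth_mono)
          then show False using a gt by auto
        qed
        then show "a \<in> (!) ?xs ` {Suc p..<card A}" using q by auto
      qed
      then have "card {a\<in>A. x \<le> a} \<le> card ((!) ?xs ` {Suc p..<card A})" by (intro card_mono) auto
      also have "\<dots> \<le> card A - Suc p" using card_image_le[of "{Suc p..<card A}" "(!) ?xs"] by simp
      finally show False using lt assms by simp
    qed
  qed
qed

section \<open>The operator and its fixed points\<close>

text \<open>A point lies weakly below the element of rank \<open>card E - d\<close> iff more than
  \<open>d\<close> elements lie weakly above it, and dually for rank \<open>d + 1\<close>. If
  \<open>card E\<close> is at most \<open>d\<close>, no count exceeds \<open>d\<close>, so one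
  formula covers both cases.\<close>

lemma L_op_eq:
  assumes "E \<subseteq> {0..N}" "0 \<le> d"
  shows "L_op N d E =
    E \<union> {x\<in>{0..N}. d < int (card {e\<in>E. x \<le> e}) \<or> d < int (card {e\<in>E. e \<le> x})}"
proof -
  have fin: "finite E" using assms finite_subset by blast
  show ?thesis
  proof (cases "int (card E) \<le> d")
    case True
    have "card {e\<in>E. x \<le> e} \<le> card E" "card {e\<in>E. e \<le> x} \<le> card E" for x
      using fin by (auto intro: card_mono)
    then have "\<not> d < int (card {e\<in>E. x \<le> e})" "\<not> d < int (card {e\<in>E. e \<le> x})" for x
      using True by (meson not_le of_nat_mono order_trans)+
    then show ?thesis using True unfolding L_op_def by simp
  next
    case False
    define s where "s = card E"
    define p where "p = nat d"
    have ps: "p < s" "d = int p" using False assms(2) unfolding s_def p_def by auto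
    \<comment> \<open>Ranks start at 1 and list positions at 0, hence the shift by one.\<close>
    have nth: "nth_elem E (int (card E) - d) = sorted_list_of_set E ! (s - Suc p)"
      "nth_elem E (d + 1) = sorted_list_of_set E ! p"
      unfolding nth_elem_def using ps s_def by (auto intro!: arg_cong[where f = "(!) _"])
    have "sorted_list_of_set E ! q \<in> {0..N}" if "q < s" for q
      using that fin assms(1) s_def by (metis length_sorted_list_of_set nth_mem set_sorted_list_of_set subsetD)
    then have rng: "sorted_list_of_set E ! (s - Suc p) \<in> {0..N}" "sorted_list_of_set E ! p \<in> {0..N}"
      using ps by auto
    have "x \<le> sorted_list_of_set E ! (s - Suc p) \<longleftrightarrow> d < int (card {e\<in>E. x \<le> e})"
      "sorted_list_of_set E ! p \<le> x \<longleftrightarrow> d < int (card {e\<in>E. e \<le> x})" for x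
      using le_sorted_list_nth_iff[OF fin, of "s - Suc p" x] sorted_list_nth_le_iff[OF fin, of p x] ps
      unfolding s_def by auto
    \<comment> \<open>By \<open>rng\<close> both thresholds lie in \<open>{0..N}\<close>, so neither
      interval sticks out of it.\<close>
    then have "{0..nth_elem E (int (card E) - d)} = {x\<in>{0..N}. d < int (card {e\<in>E. x \<le> e})}"
      "{nth_elem E (d + 1)..N} = {x\<in>{0..N}. d < int (card {e\<in>E. e \<le> x})}"
      unfolding nth using rng by force+
    then show ?thesis using False unfolding L_op_def by auto
  qed
qed

lemma L_op_subset:
  assumes "E \<subseteq> {0..N}" "0 \<le> d"
  shows "L_op N d E \<subseteq> {0..N}"
  unfolding L_op_eq[OF assms] using assms(1) by auto

lemma L_op_increasing: "E \<subseteq> L_op N d E"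
  unfolding L_op_def by auto

text \<open>The ranks in the definition shift with \<open>card E\<close>; in the counting form both
  counts visibly grow with the set.\<close>

lemma L_op_mono:
  assumes "E \<subseteq> F" "F \<subseteq> {0..N}" "0 \<le> d"
  shows "L_op N d E \<subseteq> L_op N d F"
proof -
  have "finite F" using assms(2) finite_subset by blast
  then have "card {e\<in>E. x \<le> e} \<le> card {e\<in>F. x \<le> e}" "card {e\<in>E. e \<le> x} \<le> card {e\<in>F. e \<le> x}" for x
    using assms(1) by (auto intro!: card_mono)
  then have "d < int (card {e\<in>F. x \<le> e})" if "d < int (card {e\<in>E. x \<le> e})" for x
    using that by (meson of_nat_mono order_less_le_trans)
  moreover have "d < int (card {e\<in>F. e \<le> x})" if "d < int (card {e\<in>E. e \<le> x})" for x
    using that \<open>\<And>x. card {e\<in>E. e \<le> x} \<le> card {e\<in>F. e \<le> x}\<close> by (meson of_nat_mono order_less_le_trans)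
  ultimately show ?thesis
    unfolding L_op_eq[OF assms(2,3)] L_op_eq[OF order_trans[OF assms(1,2)] assms(3)] using assms(1) by auto
qed

text \<open>With \<open>m = card E - d\<close>, more than \<open>d\<close> elements lie weakly above
  \<open>x\<close> iff fewer than \<open>m\<close> lie strictly below it. The latter is automatic
  when \<open>x < m\<close>; conversely, it fails for a missing \<open>x\<close> once
  \<open>E\<close> contains \<open>{0..<m}\<close>. The upper end is symmetric.\<close>

lemma L_op_fixed_iff:
  assumes "E \<subseteq> {0..N}" "0 \<le> d"
  shows "L_op N d E = E \<longleftrightarrow> T_set N (int (card E) - d) \<subseteq> E"
proof -
  have fin: "finite E" using assms finite_subset by blast
  define m where "m = int (card E) - d"
  have "card E = card ({e\<in>E. x \<le> e} \<union> {e\<in>E. e < x})" for x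
    by (rule arg_cong[where f = card]) auto
  then have up: "int (card E) = int (card {e\<in>E. x \<le> e}) + int (card {e\<in>E. e < x})" for x
    using fin by (subst (asm) card_Un_disjoint) (auto simp flip: of_nat_add)
  have "card E = card ({e\<in>E. e \<le> x} \<union> {e\<in>E. x < e})" for x
    by (rule arg_cong[where f = card]) auto
  then have down: "int (card E) = int (card {e\<in>E. e \<le> x}) + int (card {e\<in>E. x < e})" for x
    using fin by (subst (asm) card_Un_disjoint) (auto simp flip: of_nat_add)
  have mN: "m \<le> N + 1" if "0 < m"
  proof -
    have "card E \<le> card {0..N}" using assms by (intro card_mono) auto
    then show ?thesis using that assms(2) m_def by auto
  qed
  show ?thesis
  proof
    assume fp: "L_op N d E = E"
    show "T_set N (int (card E) - d) \<subseteq> E"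
    proof
      fix x assume "x \<in> T_set N (int (card E) - d)"
      then have x: "x \<in> {0..N}" "x < m \<or> N - m < x"
        unfolding T_set_def m_def by auto
      have "card {e\<in>E. e < x} \<le> card {0..<x}" "card {e\<in>E. x < e} \<le> card {x<..N}"
        by (rule card_mono; use assms in auto)+
      then have "int (card {e\<in>E. e < x}) \<le> x" "int (card {e\<in>E. x < e}) \<le> N - x"
        using x by auto
      \<comment> \<open>If \<open>x < m\<close>, fewer than \<open>m\<close> elements are below
        \<open>x\<close>, so \<open>up\<close> gives the first disjunct; if
        \<open>N - m < x\<close>, \<open>down\<close> gives the second.\<close>
      then have "d < int (card {e\<in>E. x \<le> e}) \<or> d < int (card {e\<in>E. e \<le> x})"
        using up[of x] down[of x] x(2) m_def by linarith
      then show "x \<in> E" using fp x(1) unfolding L_op_eq[OF assms] by auto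
    qed
  next
    assume T: "T_set N (int (card E) - d) \<subseteq> E"
    have "x \<in> E" if x: "x \<in> {0..N}" and d: "d < int (card {e\<in>E. x \<le> e})" for x
    proof (rule ccontr)
      assume "x \<notin> E"
      then have "m \<le> x" using T x unfolding T_set_def m_def by fastforce
      then have "{0..<m} \<subseteq> {e\<in>E. e < x}" using T x unfolding T_set_def m_def by fastforce
      \<comment> \<open>At least \<open>m\<close> elements lie below \<open>x\<close>, trivially so
        if \<open>m\<close> is not positive; by \<open>up\<close> at most \<open>d\<close>
        remain.\<close>
      then have "card {0..<m} \<le> card {e\<in>E. e < x}" using fin by (intro card_mono) auto
      then show False using d up[of x] m_def by auto
    qed
    moreover have "x \<in> E" if x: "x \<in> {0..N}" and d: "d < int (card {e\<in>E. e \<le> x})" for x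
    proof (rule ccontr)
      assume "x \<notin> E"
      then have "x \<le> N - m" using T x unfolding T_set_def m_def by fastforce
      then have "{N - m<..N} \<subseteq> {e\<in>E. x < e}" using T x unfolding T_set_def m_def by fastforce
      then have "card {N - m<..N} \<le> card {e\<in>E. x < e}" using fin by (intro card_mono) auto
      then show False using d down[of x] m_def by auto
    qed
    ultimately show "L_op N d E = E" unfolding L_op_eq[OF assms] by auto
  qed
qed

section \<open>The closure as least fixed point\<close>

lemma L_closure_increasing: "E \<subseteq> L_closure N d E"
proof -
  have "(L_op N d ^^ 0) E \<subseteq> L_closure N d E" unfolding L_closure_def by blast
  then show ?thesis by simp
qed

lemma L_closure_least:
  assumes "E \<subseteq> F" "F \<subseteq> {0..N}" "0 \<le> d" "L_op N d F = F"
  shows "L_closure N d E \<subseteq> F"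
proof -
  have "(L_op N d ^^ j) E \<subseteq> F" for j
    by (induction j) (use assms L_op_mono[of _ F N d] in auto)
  then show ?thesis unfolding L_closure_def by auto
qed

text \<open>The iterates increase inside a finite set, so one of maximal cardinality is fixed; by
  leastness it is the whole union.\<close>

lemma L_closure_fixed:
  assumes "E \<subseteq> {0..N}" "0 \<le> d"
  shows "L_closure N d E \<subseteq> {0..N}" "L_op N d (L_closure N d E) = L_closure N d E"
proof -
  define It where "It j = (L_op N d ^^ j) E" for j
  have sub: "It j \<subseteq> {0..N}" for j
    unfolding It_def by (induction j) (use assms L_op_subset in auto)
  then have "card (It j) < Suc (card {0..N})" for j
    by (simp add: card_mono less_Suc_eq_le del: card_atLeastAtMost_int)
  then obtain n where n: "card (It j) \<le> card (It n)" for j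
    using ex_has_greatest_nat[of "\<lambda>_. True" 0 "\<lambda>j. card (It j)" "Suc (card {0..N})"] by auto
  have "It (Suc n) = L_op N d (It n)" unfolding It_def by simp
  \<comment> \<open>The next iterate contains \<open>It n\<close> and is no larger, hence
    equal.\<close>
  then have fp: "L_op N d (It n) = It n"
    using n[of "Suc n"] card_seteq[of "It (Suc n)" "It n"] sub[of "Suc n"] L_op_increasing[of "It n" N d]
    by (metis finite_atLeastAtMost_int finite_subset)
  have "E \<subseteq> It j" for j
    unfolding It_def by (induction j) (use L_op_increasing order_trans in \<open>simp_all, blast\<close>)
  then have "L_closure N d E \<subseteq> It n" using L_closure_least[OF _ sub assms(2) fp] by blast
  moreover have "It n \<subseteq> L_closure N d E" unfolding It_def L_closure_def by blast
  ultimately have "L_closure N d E = It n" by blast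
  then show "L_closure N d E \<subseteq> {0..N}" "L_op N d (L_closure N d E) = L_closure N d E"
    using fp sub by auto
qed

lemma L_closure_eq_iff:
  assumes "E \<subseteq> {0..N}" "0 \<le> d"
  shows "L_closure N d E = E \<longleftrightarrow> L_op N d E = E"
  using L_closure_fixed(2)[OF assms] L_closure_least[OF order_refl assms] L_closure_increasing[of E N d]
  by (metis subset_antisym)

section \<open>Sizes of the end sets and admitting sets\<close>

lemma T_set_mono: "i \<le> j \<Longrightarrow> T_set N i \<subseteq> T_set N j"
  unfolding T_set_def by auto

lemma T_set_subset: "T_set N i \<subseteq> {0..N}"
  unfolding T_set_def by auto

lemma card_T_set_le:
  assumes "0 \<le> i"
  shows "int (card (T_set N i)) \<le> 2 * i"
proof -
  have "card (T_set N i) \<le> card ({0..i - 1} \<union> {N - i + 1..N})"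
    unfolding T_set_def by (intro card_mono) auto
  also have "\<dots> \<le> card {0..i - 1} + card {N - i + 1..N}" by (rule card_Un_le)
  finally show ?thesis using assms by simp
qed

text \<open>Being proper forces \<open>2 * i \<le> N\<close>, so the two ends are disjoint and not
  truncated.\<close>

lemma card_T_set_eq:
  assumes "0 \<le> i" "T_set N i \<noteq> {0..N}"
  shows "int (card (T_set N i)) = 2 * i"
proof -
  have "2 * i \<le> N"
  proof (rule ccontr)
    assume "\<not> 2 * i \<le> N"
    then have "{0..N} \<subseteq> T_set N i" unfolding T_set_def by auto
    then show False using assms(2) T_set_subset by blast
  qed
  then have "T_set N i = {0..i - 1} \<union> {N - i + 1..N}" "{0..i - 1} \<inter> {N - i + 1..N} = {}"
    using assms(1) unfolding T_set_def by auto
  then show ?thesis using assms(1) by (simp add: card_Un_disjoint)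
qed

text \<open>The same \<open>i\<close> serves the subset: shrinking the set preserves both
  conditions.\<close>

lemma d_admitting_subset:
  assumes "d_admitting N d F" "E \<subseteq> F" "F \<subseteq> {0..N}"
  shows "d_admitting N d E"
proof -
  obtain i where i: "i \<in> {0..d}" "F \<union> T_set N i \<noteq> {0..N}" "int (card (F - T_set N i)) \<le> d - i"
    using assms(1) unfolding d_admitting_def di_admitting_def by blast
  have "finite F" using assms(3) finite_subset by blast
  then have "card (E - T_set N i) \<le> card (F - T_set N i)" using assms(2) by (intro card_mono) auto
  moreover have "E \<union> T_set N i \<noteq> {0..N}" using i(2) assms(2,3) T_set_subset[of N i] by blast
  ultimately show ?thesis using i unfolding d_admitting_def di_admitting_def by (intro bexI[of _ i]) auto
qed

lemma fixed_imp_d_admitting: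
  assumes "F \<subseteq> {0..N}" "0 \<le> d" "L_op N d F = F" "F \<noteq> {0..N}"
  shows "d_admitting N d F"
proof -
  \<comment> \<open>The maximum keeps \<open>i\<close> nonnegative; for \<open>card F\<close> at
    most \<open>d\<close> the end set is empty.\<close>
  define i where "i = max 0 (int (card F) - d)"
  have T: "T_set N i \<subseteq> F"
  proof (cases "int (card F) \<le> d")
    case True
    then show ?thesis unfolding i_def T_set_def by auto
  next
    case False
    then show ?thesis using L_op_fixed_iff[OF assms(1,2)] assms(3) unfolding i_def by auto
  qed
  have fin: "finite F" using assms(1) finite_subset by blast
  \<comment> \<open>Since \<open>F\<close> is proper, so is the end set inside it, and its size is
    exact.\<close>
  have "int (card (T_set N i)) = 2 * i"
    using T assms(1,4) by (intro card_T_set_eq) (auto simp: i_def)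
  moreover have "card (F - T_set N i) = card F - card (T_set N i)" "card (T_set N i) \<le> card F"
    using T fin by (auto intro: card_Diff_subset card_mono finite_subset)
  ultimately have "int (card (F - T_set N i)) = int (card F) - 2 * i" by auto
  then have "int (card (F - T_set N i)) \<le> d - i" unfolding i_def by auto
  \<comment> \<open>The bound \<open>i \<le> d\<close> holds because \<open>d - i\<close> dominates
    a cardinality.\<close>
  moreover from this have "i \<in> {0..d}" unfolding i_def by auto
  moreover have "F \<union> T_set N i \<noteq> {0..N}" using T assms(4) by (simp add: Un_absorb2)
  ultimately show ?thesis unfolding d_admitting_def di_admitting_def by blast
qed

lemma L_closure_ne_iff_d_admitting:
  assumes "E \<subseteq> {0..N}" "0 \<le> d"
  shows "L_closure N d E \<noteq> {0..N} \<longleftrightarrow> d_admitting N d E"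
proof
  assume "L_closure N d E \<noteq> {0..N}"
  then have "d_admitting N d (L_closure N d E)"
    using L_closure_fixed[OF assms] assms(2) by (intro fixed_imp_d_admitting)
  then show "d_admitting N d E"
    using L_closure_increasing L_closure_fixed(1)[OF assms] by (rule d_admitting_subset)
next
  assume "d_admitting N d E"
  then obtain i where i: "i \<in> {0..d}" "E \<union> T_set N i \<noteq> {0..N}" "int (card (E - T_set N i)) \<le> d - i"
    unfolding d_admitting_def di_admitting_def by blast
  define F where "F = E \<union> T_set N i"
  have F: "F \<subseteq> {0..N}" unfolding F_def using assms(1) T_set_subset by blast
  have "F = (E - T_set N i) \<union> T_set N i" unfolding F_def by auto
  then have "card F \<le> card (E - T_set N i) + card (T_set N i)" by (metis card_Un_le)
  \<comment> \<open>The count is \<open>(d - i) + 2 * i = d + i\<close>, so the end set required by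
    the fixed-point criterion lies in \<open>T_set N i\<close>.\<close>
  then have "int (card F) - d \<le> i" using i card_T_set_le[of i N] by auto
  then have "T_set N (int (card F) - d) \<subseteq> F" using T_set_mono unfolding F_def by blast
  then have "L_closure N d E \<subseteq> F"
    using F assms(2) L_op_fixed_iff[OF F assms(2)] by (intro L_closure_least) (auto simp: F_def)
  then show "L_closure N d E \<noteq> {0..N}" using i(2) F unfolding F_def by blast
qed

theorem proposition1p8:
  fixes k :: "'n::finite \<Rightarrow> int" and N :: int
  assumes "\<forall>i. k i \<ge> 2"
    and "N = grid_N k"
    and "strictly_unimodal k"
  shows "\<forall>d\<in>{0..N}. \<forall>E. E \<subseteq> {0..N} \<longrightarrow>
    (L_closure N d E \<noteq> {0..N} \<longleftrightarrow> d_admitting N d E) \<and>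
    (L_closure N d E = E \<longleftrightarrow> T_set N (int (card E) - d) \<subseteq> E)"
  \<comment> \<open>The second equivalence passes through \<open>L_op N d E = E\<close>.\<close>
  using L_closure_ne_iff_d_admitting L_closure_eq_iff L_op_fixed_iff by auto

end
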